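(* The eight mesh patterns $(12,R)$, where $R$ ranges over the sets $\{(0,2),(2,2),(1,1),(2,1),(0,0)\}$, $\{(0,2),(2,2),(1,1),(0,0),(1,0)\}$, $\{(1,2),(2,2),(1,1),(0,0),(2,0)\}$, $\{(2,2),(0,1),(1,1),(0,0),(2,0)\}$, $\{(0,2),(2,2),(0,1),(1,1),(2,0)\}$, $\{(0,2),(1,2),(1,1),(0,0),(2,0)\}$, $\{(0,2),(1,1),(2,1),(0,0),(2,0)\}$, $\{(0,2),(2,2),(1,1),(1,0),(2,0)\}$, are all equidistributed; that is, for any two of them, $p$ and $p'$, one has $s_{n,k}(p)=s_{n,k}(p')$ for all $n,k\ge 0$.
   Context: $\mathfrak S_n$ is the set of permutations of $\{1,\dots,n\}$ in one-line notation $\sigma=\sigma_1\cdots\sigma_n$. For $R\subseteq\{0,1,2\}^2$, an occurrence of the mesh pattern $(12,R)$ in $\sigma\in\mathfrak S_n$ is a pair of positions $i_1<i_2$ with $\sigma_{i_1}<\sigma_{i_2}$ such that, setting $i_0=0$, $i_3=n+1$, $v_0=0$, $v_1=\sigma_{i_1}$, $v_2=\sigma_{i_2}$, $v_3=n+1$, for every $(x,y)\in R$ there is no index $\ell$ with $i_x<\ell<i_{x+1}$ and $v_y<\sigma_\ell<v_{y+1}$. $s_{n,k}(p)$ is the number of $\sigma\in\mathfrak S_n$ with exactly $k$ occurrences of $p$. *)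

theory Defs
  imports "HOL-Combinatorics.Permutations"
begin

text \<open>
  A permutation of \<open>{1, \<dots>, n}\<close> is a function \<open>\<sigma>\<close> with \<open>\<sigma> permutes {1..n}\<close>; its one-line notation is
  \<open>\<sigma> 1 \<dots> \<sigma> n\<close>.  A mesh pattern with underlying permutation \<open>12\<close> is given by its set \<open>R\<close> of shaded
  boxes, where the box \<open>(x, y)\<close> has column \<open>x\<close> and row \<open>y\<close>.
\<close>

text \<open>
  The lists below are \<open>i\<^sub>0, i\<^sub>1, i\<^sub>2, i\<^sub>3\<close> and \<open>v\<^sub>0, v\<^sub>1, v\<^sub>2, v\<^sub>3\<close>; only boxes with
  \<open>x, y \<le> 2\<close> are meaningful.
\<close>

definition mesh12_occurrence ::
    "nat \<Rightarrow> (nat \<times> nat) set \<Rightarrow> (nat \<Rightarrow> nat) \<Rightarrow> nat \<Rightarrow> nat \<Rightarrow> bool" where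
  "mesh12_occurrence n R \<sigma> i\<^sub>1 i\<^sub>2 \<longleftrightarrow>
     i\<^sub>1 \<in> {1..n} \<and> i\<^sub>2 \<in> {1..n} \<and> i\<^sub>1 < i\<^sub>2 \<and> \<sigma> i\<^sub>1 < \<sigma> i\<^sub>2 \<and>
     (let i = (!) [0, i\<^sub>1, i\<^sub>2, n + 1]; v = (!) [0, \<sigma> i\<^sub>1, \<sigma> i\<^sub>2, n + 1]
      in \<forall>(x, y) \<in> R. \<not> (\<exists>l \<in> {1..n}. i x < l \<and> l < i (x + 1) \<and> v y < \<sigma> l \<and> \<sigma> l < v (y + 1)))"

definition mesh12_occurrences ::
    "nat \<Rightarrow> (nat \<times> nat) set \<Rightarrow> (nat \<Rightarrow> nat) \<Rightarrow> (nat \<times> nat) set" where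
  "mesh12_occurrences n R \<sigma> = {(i\<^sub>1, i\<^sub>2). mesh12_occurrence n R \<sigma> i\<^sub>1 i\<^sub>2}"

definition s_mesh12 :: "nat \<Rightarrow> nat \<Rightarrow> (nat \<times> nat) set \<Rightarrow> nat" where
  "s_mesh12 n k R = card {\<sigma>. \<sigma> permutes {1..n} \<and> card (mesh12_occurrences n R \<sigma>) = k}"

definition equidistributed_mesh12 :: "(nat \<times> nat) set \<Rightarrow> (nat \<times> nat) set \<Rightarrow> bool" where
  "equidistributed_mesh12 R R' \<longleftrightarrow> (\<forall>n k. s_mesh12 n k R = s_mesh12 n k R')"

end

theory Submission
  imports Defs
begin

text \<open>
  Inversion and the half turn of permutation diagrams permute mesh patterns and preserve their
  distributions.  Under these symmetries the eight patterns form two orbits of four, represented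
  by \<open>R_lr\<close> and \<open>R_rl\<close>, which differ in one corner box only.  It remains to show that these two
  patterns are equidistributed.

  The four boxes common to both say that the values above \<open>\<sigma> j\<close> occupy exactly the positions
  strictly between \<open>i\<close> and \<open>j\<close>.  The corner box adds that \<open>\<sigma> i\<close> is a left-to-right minimum
  (for \<open>R_lr\<close>) or a right-to-left minimum (for \<open>R_rl\<close>).  Of two such runs one contains the
  other.  If they start at different positions, the first letter of the inner run exceeds both
  the first and the last letter of the outer one, hence is no minimum in either direction.  So
  all occurrences in one permutation share \<open>i\<close>, and the occurrences are counted by the possible \<open>j\<close>
  (\<open>card_occurrences_lr\<close>, \<open>card_occurrences_rl\<close>).

  Let \<open>a\<close> be a left-to-right minimum and write the permutation as a word \<open>L a K T\<close>, where \<open>K\<close> is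
  the longest block after \<open>a\<close> with all letters above \<open>a\<close>.  Send it to \<open>L T a K\<close>, in which \<open>a\<close> is
  a right-to-left minimum.  Since all letters of \<open>L\<close> exceed \<open>a\<close>, the block \<open>T\<close> starts at the first
  letter below \<open>a\<close> and can be recognised again, so this is a bijection between permutations with
  a marked left-to-right minimum and permutations with a marked right-to-left minimum.  A run of
  top values after \<open>a\<close> consists of letters above \<open>a\<close>, so it lies in \<open>K\<close> and is carried along:
  the number of runs after \<open>a\<close> is preserved (\<open>card_lr_splits_eq_card_rl_splits\<close>).  When there
  is at least one occurrence, the marked letter is determined by the permutation, which gives the
  equality for every positive number of occurrences; passing to complements in the set of all
  permutations gives it for zero.
\<close>

section \<open>Symmetries of the square\<close>

lemma s_mesh12_eq_by_involution:
  assumes perm: "\<And>\<sigma>. \<sigma> permutes {1..n} \<Longrightarrow> \<phi> \<sigma> permutes {1..n}"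
    and invol: "\<And>\<sigma>. \<sigma> permutes {1..n} \<Longrightarrow> \<phi> (\<phi> \<sigma>) = \<sigma>"
    and card: "\<And>\<sigma>. \<sigma> permutes {1..n} \<Longrightarrow>
      card (mesh12_occurrences n R' (\<phi> \<sigma>)) = card (mesh12_occurrences n R \<sigma>)"
  shows "s_mesh12 n k R = s_mesh12 n k R'"
  unfolding s_mesh12_def
proof (rule bij_betw_same_card, rule bij_betw_byWitness[where f' = \<phi>])
  let ?A = "{\<sigma>. \<sigma> permutes {1..n} \<and> card (mesh12_occurrences n R \<sigma>) = k}"
  let ?B = "{\<sigma>. \<sigma> permutes {1..n} \<and> card (mesh12_occurrences n R' \<sigma>) = k}"
  show "\<phi> ` ?A \<subseteq> ?B" using perm card by auto
  show "\<phi> ` ?B \<subseteq> ?A" using perm card[OF perm] invol by fastforce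
qed (use invol in auto)

lemma mesh12_occurrence_inverse:
  assumes "\<sigma> permutes {1..n}" and "mesh12_occurrence n R \<sigma> i j"
  shows "mesh12_occurrence n (R\<inverse>) (inv \<sigma>) (\<sigma> i) (\<sigma> j)"
proof -
  have inv: "inv \<sigma> (\<sigma> l) = l" "\<sigma> (inv \<sigma> l) = l" for l
    using assms(1) by (simp_all add: permutes_inverses)
  have mem: "\<sigma> l \<in> {1..n} \<longleftrightarrow> l \<in> {1..n}" "inv \<sigma> l \<in> {1..n} \<longleftrightarrow> l \<in> {1..n}" for l
    using permutes_in_image[OF assms(1)] permutes_in_image[OF permutes_inv[OF assms(1)]] by blast+
  let ?i = "(!) [0, i, j, n + 1]" and ?v = "(!) [0, \<sigma> i, \<sigma> j, n + 1]"
  have ij: "i \<in> {1..n}" "j \<in> {1..n}" "i < j" "\<sigma> i < \<sigma> j"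
    and emp: "\<And>x y l. (x, y) \<in> R \<Longrightarrow> l \<in> {1..n} \<Longrightarrow>
        \<not> (?i x < l \<and> l < ?i (x + 1) \<and> ?v y < \<sigma> l \<and> \<sigma> l < ?v (y + 1))"
    using assms(2) unfolding mesh12_occurrence_def Let_def by blast+
  have "\<not> (?v y < m \<and> m < ?v (y + 1) \<and> ?i x < inv \<sigma> m \<and> inv \<sigma> m < ?i (x + 1))"
    if "(x, y) \<in> R" "m \<in> {1..n}" for x y m
    using emp[of x y "inv \<sigma> m"] that mem inv by auto
  with ij mem(1) show ?thesis
    unfolding mesh12_occurrence_def Let_def inv(1) by blast
qed

text \<open>Transposing the diagram of a permutation transposes the boxes of the mesh.\<close>

lemma s_mesh12_converse: "s_mesh12 n k (R\<inverse>) = s_mesh12 n k R"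
proof (rule sym, rule s_mesh12_eq_by_involution[where \<phi> = inv])
  fix \<sigma> :: "nat \<Rightarrow> nat"
  assume \<sigma>: "\<sigma> permutes {1..n}"
  have inv: "inv \<sigma> (\<sigma> l) = l" "\<sigma> (inv \<sigma> l) = l" for l
    using \<sigma> by (simp_all add: permutes_inverses)
  show "inv \<sigma> permutes {1..n}" "inv (inv \<sigma>) = \<sigma>"
    using \<sigma> by (simp_all add: permutes_inv permutes_inv_inv)
  have "bij_betw (map_prod \<sigma> \<sigma>) (mesh12_occurrences n R \<sigma>)
      (mesh12_occurrences n (R\<inverse>) (inv \<sigma>))"
  proof (rule bij_betw_byWitness[where f' = "map_prod (inv \<sigma>) (inv \<sigma>)"])
    show "map_prod \<sigma> \<sigma> ` mesh12_occurrences n R \<sigma> \<subseteq> mesh12_occurrences n (R\<inverse>) (inv \<sigma>)"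
      using mesh12_occurrence_inverse[OF \<sigma>] by (auto simp: mesh12_occurrences_def)
    show "map_prod (inv \<sigma>) (inv \<sigma>) ` mesh12_occurrences n (R\<inverse>) (inv \<sigma>)
        \<subseteq> mesh12_occurrences n R \<sigma>"
      using mesh12_occurrence_inverse[OF permutes_inv[OF \<sigma>], of "R\<inverse>"] permutes_inv_inv[OF \<sigma>]
      by (auto simp: mesh12_occurrences_def)
  qed (auto simp: inv)
  then show "card (mesh12_occurrences n (R\<inverse>) (inv \<sigma>)) = card (mesh12_occurrences n R \<sigma>)"
    by (simp add: bij_betw_same_card)
qed

definition flip :: "nat \<Rightarrow> nat \<Rightarrow> nat" where
  "flip n i = (if i \<in> {1..n} then n + 1 - i else i)"

lemma flip_flip [simp]: "flip n (flip n i) = i"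
  by (auto simp: flip_def)

lemma flip_permutes: "flip n permutes {1..n}"
proof (rule bij_imp_permutes)
  show "bij_betw (flip n) {1..n} {1..n}"
    by (rule bij_betw_byWitness[where f' = "flip n"]) (auto simp: flip_def)
qed (auto simp: flip_def)

lemma mesh12_occurrence_reverse_complement:
  assumes \<sigma>: "\<sigma> permutes {1..n}" and R: "R \<subseteq> {..2} \<times> {..2}"
    and occ: "mesh12_occurrence n R \<sigma> i j"
  shows "mesh12_occurrence n (map_prod ((-) 2) ((-) 2) ` R) (flip n \<circ> \<sigma> \<circ> flip n)
    (flip n j) (flip n i)"
proof -
  have mem: "\<sigma> l \<in> {1..n}" "flip n l \<in> {1..n}" if "l \<in> {1..n}" for l
    using permutes_in_image[OF \<sigma>] permutes_in_image[OF flip_permutes] that by blast+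
  have flip: "flip n l = n + 1 - l" if "l \<in> {1..n}" for l
    using that by (simp add: flip_def)
  let ?i = "(!) [0, i, j, n + 1]" and ?v = "(!) [0, \<sigma> i, \<sigma> j, n + 1]"
  let ?i' = "(!) [0, flip n j, flip n i, n + 1]"
  let ?v' = "(!) [0, flip n (\<sigma> j), flip n (\<sigma> i), n + 1]"
  have ij: "i \<in> {1..n}" "j \<in> {1..n}" "i < j" "\<sigma> i < \<sigma> j"
    and emp: "\<And>x y l. (x, y) \<in> R \<Longrightarrow> l \<in> {1..n} \<Longrightarrow>
        \<not> (?i x < l \<and> l < ?i (x + 1) \<and> ?v y < \<sigma> l \<and> \<sigma> l < ?v (y + 1))"
    using occ unfolding mesh12_occurrence_def Let_def by blast+
  have mirror: "[0, flip n b, flip n a, n + 1] ! (2 - x) < flip n l \<and>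
      flip n l < [0, flip n b, flip n a, n + 1] ! (2 - x + 1) \<longleftrightarrow>
      [0, a, b, n + 1] ! x < l \<and> l < [0, a, b, n + 1] ! (x + 1)"
    if "x \<le> 2" "a \<in> {1..n}" "b \<in> {1..n}" "l \<in> {1..n}" for x a b l
  proof -
    have "x = 0 \<or> x = 1 \<or> x = 2" using that(1) by auto
    then show ?thesis using that by (auto simp: flip)
  qed
  have "\<not> (?i' (2 - x) < l \<and> l < ?i' (2 - x + 1) \<and>
      ?v' (2 - y) < flip n (\<sigma> (flip n l)) \<and> flip n (\<sigma> (flip n l)) < ?v' (2 - y + 1))"
    if "(x, y) \<in> R" "l \<in> {1..n}" for x y l
  proof -
    have xy: "x \<le> 2" "y \<le> 2" using R that(1) by auto
    note l = mem(2)[OF that(2)]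
    from emp[OF that(1) l] show ?thesis
      using mirror[OF xy(1) ij(1,2) l] mirror[OF xy(2) mem(1)[OF ij(1)] mem(1)[OF ij(2)] mem(1)[OF l]]
      by (simp only: flip_flip) blast
  qed
  then have "\<forall>(x, y) \<in> map_prod ((-) 2) ((-) 2) ` R. \<not> (\<exists>l \<in> {1..n}. ?i' x < l \<and> l < ?i' (x + 1) \<and>
      ?v' y < flip n (\<sigma> (flip n l)) \<and> flip n (\<sigma> (flip n l)) < ?v' (y + 1))"
    by fastforce
  moreover have "flip n j < flip n i" "flip n (\<sigma> j) < flip n (\<sigma> i)"
    using ij mem(1)[OF ij(1)] mem(1)[OF ij(2)] by (auto simp: flip)
  ultimately show ?thesis
    using mem(2)[OF ij(1)] mem(2)[OF ij(2)]
    unfolding mesh12_occurrence_def Let_def by simp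
qed

text \<open>Rotating the diagram by a half turn rotates the boxes of the mesh.\<close>

lemma s_mesh12_half_turn:
  assumes R: "R \<subseteq> {..2} \<times> {..2}"
  shows "s_mesh12 n k (map_prod ((-) 2) ((-) 2) ` R) = s_mesh12 n k R"
proof (rule sym, rule s_mesh12_eq_by_involution[where \<phi> = "\<lambda>\<sigma>. flip n \<circ> \<sigma> \<circ> flip n"])
  let ?rot = "\<lambda>R :: (nat \<times> nat) set. map_prod ((-) 2) ((-) 2) ` R"
  let ?\<phi> = "\<lambda>\<sigma>. flip n \<circ> \<sigma> \<circ> flip n"
  fix \<sigma> :: "nat \<Rightarrow> nat"
  assume \<sigma>: "\<sigma> permutes {1..n}"
  show perm: "?\<phi> \<sigma> permutes {1..n}"
    by (intro permutes_compose flip_permutes \<sigma>)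
  show invol: "?\<phi> (?\<phi> \<sigma>) = \<sigma>"
    by (simp add: fun_eq_iff)
  have R': "?rot R \<subseteq> {..2} \<times> {..2}" by auto
  have RR: "?rot (?rot R) = R"
    using R by (force simp: image_image map_prod_def split: prod.splits)
  have "bij_betw (\<lambda>(i, j). (flip n j, flip n i)) (mesh12_occurrences n R \<sigma>)
      (mesh12_occurrences n (?rot R) (?\<phi> \<sigma>))"
  proof (rule bij_betw_byWitness[where f' = "\<lambda>(i, j). (flip n j, flip n i)"])
    show "(\<lambda>(i, j). (flip n j, flip n i)) ` mesh12_occurrences n R \<sigma>
        \<subseteq> mesh12_occurrences n (?rot R) (?\<phi> \<sigma>)"
      using mesh12_occurrence_reverse_complement[OF \<sigma> R] by (auto simp: mesh12_occurrences_def)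
    show "(\<lambda>(i, j). (flip n j, flip n i)) ` mesh12_occurrences n (?rot R) (?\<phi> \<sigma>)
        \<subseteq> mesh12_occurrences n R \<sigma>"
      using mesh12_occurrence_reverse_complement[OF perm R'] unfolding RR invol
      by (auto simp: mesh12_occurrences_def)
  qed auto
  then show "card (mesh12_occurrences n (?rot R) (?\<phi> \<sigma>)) = card (mesh12_occurrences n R \<sigma>)"
    by (simp add: bij_betw_same_card)
qed

section \<open>The shape of an occurrence\<close>

definition top_run :: "nat \<Rightarrow> (nat \<Rightarrow> nat) \<Rightarrow> nat \<Rightarrow> nat \<Rightarrow> bool" where
  "top_run n \<sigma> i j \<longleftrightarrow> i \<in> {1..n} \<and> j \<in> {1..n} \<and> i < j \<and>
     (\<forall>l \<in> {1..n}. \<sigma> j < \<sigma> l \<longleftrightarrow> i < l \<and> l < j)"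

text \<open>
  \<open>R_core\<close> forces a run of top values; the two representatives add one corner box each.
\<close>

abbreviation R_core :: "(nat \<times> nat) set" where
  "R_core \<equiv> {(0,2), (2,2), (1,1), (1,0)}"

abbreviation R_lr :: "(nat \<times> nat) set" where
  "R_lr \<equiv> insert (0,0) R_core"

abbreviation R_rl :: "(nat \<times> nat) set" where
  "R_rl \<equiv> insert (2,0) R_core"

lemma permutes_bounds:
  assumes "\<sigma> permutes {1..n}" "l \<in> {1..n}"
  shows "0 < \<sigma> l" "\<sigma> l < Suc n"
  using permutes_in_image[OF assms(1), of l] assms(2) by auto

lemma top_run_less:
  assumes "\<sigma> permutes {1..n}" "top_run n \<sigma> i j"
  shows "\<sigma> i < \<sigma> j"
proof -
  have "\<sigma> i \<noteq> \<sigma> j"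
    using assms by (auto simp: top_run_def inj_eq[OF permutes_inj])
  moreover have "\<not> \<sigma> j < \<sigma> i"
    using assms(2) by (auto simp: top_run_def)
  ultimately show ?thesis by simp
qed

text \<open>
  The boxes \<open>(1,1)\<close> and \<open>(1,0)\<close> leave only values above \<open>\<sigma> j\<close> between the two positions, while
  \<open>(0,2)\<close> and \<open>(2,2)\<close> forbid such values elsewhere.
\<close>

lemma mesh12_occurrence_core_iff:
  assumes \<sigma>: "\<sigma> permutes {1..n}"
  shows "mesh12_occurrence n R_core \<sigma> i j \<longleftrightarrow> top_run n \<sigma> i j"
proof -
  have inj: "\<sigma> a = \<sigma> b \<longleftrightarrow> a = b" for a b using inj_eq[OF permutes_inj[OF \<sigma>]] .
  have b: "0 < l" "l < Suc n" "0 < \<sigma> l" "\<sigma> l < Suc n" if "l \<in> {1..n}" for l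
    using permutes_bounds[OF \<sigma> that] that by auto
  have unf: "mesh12_occurrence n R_core \<sigma> i j \<longleftrightarrow> i \<in> {1..n} \<and> j \<in> {1..n} \<and> i < j \<and> \<sigma> i < \<sigma> j \<and>
    (\<forall>l \<in> {1..n}. (l < i \<longrightarrow> \<not> \<sigma> j < \<sigma> l) \<and> (j < l \<longrightarrow> \<not> \<sigma> j < \<sigma> l) \<and>
       (i < l \<and> l < j \<longrightarrow> \<not> (\<sigma> i < \<sigma> l \<and> \<sigma> l < \<sigma> j) \<and> \<not> \<sigma> l < \<sigma> i))"
    by (simp add: mesh12_occurrence_def Let_def ball_conj_distrib b cong: conj_cong
        del: atLeastAtMost_iff) blast
  have pointwise: "(l < i \<longrightarrow> \<not> \<sigma> j < \<sigma> l) \<and> (j < l \<longrightarrow> \<not> \<sigma> j < \<sigma> l) \<and>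
       (i < l \<and> l < j \<longrightarrow> \<not> (\<sigma> i < \<sigma> l \<and> \<sigma> l < \<sigma> j) \<and> \<not> \<sigma> l < \<sigma> i) \<longleftrightarrow>
      (\<sigma> j < \<sigma> l \<longleftrightarrow> i < l \<and> l < j)" if "i < j" "\<sigma> i < \<sigma> j" for l
    using that inj[of l i] inj[of l j]
    by (cases l i rule: linorder_cases; cases l j rule: linorder_cases) auto
  show ?thesis
    unfolding unf top_run_def
    using pointwise top_run_less[OF \<sigma>, of i j] unfolding top_run_def by blast
qed

lemma mesh12_occurrence_insert:
  "mesh12_occurrence n (insert (x, y) R) \<sigma> i j \<longleftrightarrow> mesh12_occurrence n R \<sigma> i j \<and>
    mesh12_occurrence n {(x, y)} \<sigma> i j"
  unfolding mesh12_occurrence_def Let_def by blast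

lemma mesh12_occurrence_lr_iff:
  assumes \<sigma>: "\<sigma> permutes {1..n}"
  shows "mesh12_occurrence n R_lr \<sigma> i j \<longleftrightarrow>
    top_run n \<sigma> i j \<and> (\<forall>l \<in> {1..<i}. \<sigma> i < \<sigma> l)"
proof -
  have "mesh12_occurrence n {(0, 0)} \<sigma> i j \<longleftrightarrow> (\<forall>l \<in> {1..<i}. \<sigma> i < \<sigma> l)" if "top_run n \<sigma> i j"
  proof -
    have "\<sigma> l < \<sigma> i \<longleftrightarrow> \<not> \<sigma> i < \<sigma> l" if "l < i" for l
      using that inj_eq[OF permutes_inj[OF \<sigma>], of l i] by auto
    moreover have "0 < \<sigma> l" if "l \<in> {1..n}" for l
      using permutes_bounds[OF \<sigma> that] by simp
    ultimately show ?thesis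
      using that top_run_less[OF \<sigma> that] unfolding top_run_def mesh12_occurrence_def Let_def
      by auto
  qed
  then show ?thesis
    unfolding mesh12_occurrence_insert[of n 0 0 R_core] mesh12_occurrence_core_iff[OF \<sigma>] by blast
qed

text \<open>
  The box \<open>(2,0)\<close> only concerns positions after \<open>j\<close>; the run supplies the inequality for the
  positions after \<open>i\<close> up to \<open>j\<close>.
\<close>

lemma mesh12_occurrence_rl_iff:
  assumes \<sigma>: "\<sigma> permutes {1..n}"
  shows "mesh12_occurrence n R_rl \<sigma> i j \<longleftrightarrow>
    top_run n \<sigma> i j \<and> (\<forall>l \<in> {i<..n}. \<sigma> i < \<sigma> l)"
proof -
  have "mesh12_occurrence n {(2, 0)} \<sigma> i j \<longleftrightarrow> (\<forall>l \<in> {i<..n}. \<sigma> i < \<sigma> l)" if run: "top_run n \<sigma> i j"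
  proof -
    have ij: "i \<in> {1..n}" "j \<in> {1..n}" "i < j" "\<sigma> i < \<sigma> j"
      using run top_run_less[OF \<sigma> run] by (auto simp: top_run_def)
    have neq: "\<sigma> l < \<sigma> i \<longleftrightarrow> \<not> \<sigma> i < \<sigma> l" if "i < l" for l
      using that inj_eq[OF permutes_inj[OF \<sigma>], of l i] by auto
    have pos: "0 < \<sigma> l" if "l \<in> {1..n}" for l
      using permutes_bounds[OF \<sigma> that] by simp
    have "mesh12_occurrence n {(2, 0)} \<sigma> i j \<longleftrightarrow> (\<forall>l \<in> {j<..n}. \<sigma> i < \<sigma> l)"
      using ij neq pos unfolding mesh12_occurrence_def Let_def by auto
    moreover have "\<sigma> i < \<sigma> l" if "i < l" "l \<le> j" for l
      using that run ij by (cases "l = j") (auto simp: top_run_def dest!: bspec[of _ _ l])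
    ultimately show ?thesis
      using ij by (meson greaterThanAtMost_iff le_less_trans linorder_not_le order.strict_trans)
  qed
  then show ?thesis
    unfolding mesh12_occurrence_insert[of n 2 0 R_core] mesh12_occurrence_core_iff[OF \<sigma>] by blast
qed

text \<open>
  Of two runs, the one ending in the smaller value contains the other.  If the starts differ, the
  later start therefore lies inside the run that starts first.
\<close>

lemma top_run_later_start_inside:
  assumes \<sigma>: "\<sigma> permutes {1..n}" and t: "top_run n \<sigma> i j" "top_run n \<sigma> i' j'" and "i < i'"
  shows "i' < j \<and> \<sigma> j < \<sigma> i'"
proof -
  have in': "i' \<in> {1..n}" "j \<in> {1..n}" "j' \<in> {1..n}" "i \<in> {1..n}" "i < j" "i' < j'"
    and r: "\<And>l. l \<in> {1..n} \<Longrightarrow> \<sigma> j < \<sigma> l \<longleftrightarrow> i < l \<and> l < j"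
    and r': "\<And>l. l \<in> {1..n} \<Longrightarrow> \<sigma> j' < \<sigma> l \<longleftrightarrow> i' < l \<and> l < j'"
    using t by (auto simp: top_run_def)
  consider "j = j'" | "\<sigma> j < \<sigma> j'" | "\<sigma> j' < \<sigma> j"
    using inj_eq[OF permutes_inj[OF \<sigma>], of j j'] by fastforce
  then show ?thesis
  proof cases
    case 1
    then show ?thesis using r[OF in'(1)] in' \<open>i < i'\<close> by auto
  next
    case 2
    then have "j' < j" using r[OF in'(3)] by simp
    then show ?thesis using r[OF in'(1)] in' \<open>i < i'\<close> by auto
  next
    case 3
    then have "i' < j" using r'[OF in'(2)] by simp
    then show ?thesis using r[OF in'(1)] \<open>i < i'\<close> by auto
  qed
qed

text \<open>
  A later start \<open>a'\<close> lies inside the run after \<open>a\<close>, so \<open>\<sigma> a < \<sigma> a'\<close>, although \<open>a\<close> comes before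
  the left-to-right minimum at \<open>a'\<close>.
\<close>

lemma top_run_start_unique_lr:
  assumes \<sigma>: "\<sigma> permutes {1..n}" and "top_run n \<sigma> i j" "top_run n \<sigma> i' j'"
    and "\<forall>l \<in> {1..<i}. \<sigma> i < \<sigma> l" "\<forall>l \<in> {1..<i'}. \<sigma> i' < \<sigma> l"
  shows "i = i'"
proof -
  have "\<not> a < a'" if "top_run n \<sigma> a b" "top_run n \<sigma> a' b'" "\<forall>l \<in> {1..<a'}. \<sigma> a' < \<sigma> l" for a b a' b'
  proof
    assume "a < a'"
    from top_run_later_start_inside[OF \<sigma> that(1,2) this] top_run_less[OF \<sigma> that(1)]
    have "\<sigma> a < \<sigma> a'" by simp
    moreover have "\<sigma> a' < \<sigma> a" using that \<open>a < a'\<close> by (auto simp: top_run_def)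
    ultimately show False by simp
  qed
  with assms show ?thesis by (meson linorder_neqE_nat)
qed

text \<open>
  A later start \<open>a'\<close> lies inside the run after \<open>a\<close>; the value that ends this run is smaller and
  comes after the right-to-left minimum at \<open>a'\<close>.
\<close>

lemma top_run_start_unique_rl:
  assumes \<sigma>: "\<sigma> permutes {1..n}" and "top_run n \<sigma> i j" "top_run n \<sigma> i' j'"
    and "\<forall>l \<in> {i<..n}. \<sigma> i < \<sigma> l" "\<forall>l \<in> {i'<..n}. \<sigma> i' < \<sigma> l"
  shows "i = i'"
proof -
  have "\<not> a < a'" if "top_run n \<sigma> a b" "top_run n \<sigma> a' b'" "\<forall>l \<in> {a'<..n}. \<sigma> a' < \<sigma> l" for a b a' b'
  proof
    assume "a < a'"
    with top_run_later_start_inside[OF \<sigma> that(1,2)] have "a' < b" "\<sigma> b < \<sigma> a'" by auto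
    moreover from this have "\<sigma> a' < \<sigma> b" using that(1,3) by (simp add: top_run_def)
    ultimately show False by simp
  qed
  with assms show ?thesis by (meson linorder_neqE_nat)
qed

section \<open>Exchanging two blocks at the end of a permutation\<close>

text \<open>
  For \<open>1 \<le> x \<le> y \<le> n + 1\<close>, precomposition with this map exchanges the adjacent blocks at
  positions \<open>{x..<y}\<close> and \<open>{y..n}\<close>.
  The block that was second ends just before position \<open>x + (n + 1 - y)\<close>, so exchanging at that
  position restores the original order.
\<close>

definition exchange :: "nat \<Rightarrow> nat \<Rightarrow> nat \<Rightarrow> nat \<Rightarrow> nat" where
  "exchange n x y i =
     (if i < x \<or> n < i then i
      else if i < x + (n + 1 - y) then i + (y - x)
      else i - (n + 1 - y))"

lemma exchange_exchange:
  assumes "1 \<le> x" "x \<le> y" "y \<le> n + 1"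
  shows "exchange n x y (exchange n x (x + (n + 1 - y)) i) = i"
    and "exchange n x (x + (n + 1 - y)) (exchange n x y i) = i"
  using assms by (auto simp: exchange_def)

lemma exchange_in:
  assumes "1 \<le> x" "x \<le> y" "y \<le> n + 1" "i \<in> {1..n}"
  shows "exchange n x y i \<in> {1..n}"
  using assms by (auto simp: exchange_def)

lemma exchange_permutes:
  assumes "1 \<le> x" "x \<le> y" "y \<le> n + 1"
  shows "exchange n x y permutes {1..n}"
proof (rule bij_imp_permutes)
  let ?z = "x + (n + 1 - y)"
  show "bij_betw (exchange n x y) {1..n} {1..n}"
  proof (rule bij_betw_byWitness[where f' = "exchange n x ?z"])
    show "exchange n x y ` {1..n} \<subseteq> {1..n}"
      using exchange_in[OF assms] by blast
    show "exchange n x ?z ` {1..n} \<subseteq> {1..n}"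
      using exchange_in[of x ?z n] assms by fastforce
  qed (use exchange_exchange[OF assms] in auto)
qed (use assms in \<open>auto simp: exchange_def\<close>)

text \<open>
  The run from \<open>x\<close> to \<open>j\<close> lies in the first block and is shifted as a whole; the order of the letters
  outside a run does not affect whether it is one.
\<close>

lemma top_run_exchange:
  assumes "1 \<le> x" "x < y" "y \<le> n + 1" "j < y"
  shows "top_run n (\<sigma> \<circ> exchange n x y) (x + (n + 1 - y)) (j + (n + 1 - y)) \<longleftrightarrow> top_run n \<sigma> x j"
proof (cases "x < j")
  case False
  then show ?thesis by (simp add: top_run_def)
next
  case True
  let ?z = "x + (n + 1 - y)" and ?j = "j + (n + 1 - y)" and ?e = "exchange n x y"
  have xy: "x \<le> y" using assms by simp
  have ej: "?e ?j = j" using assms True by (auto simp: exchange_def)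
  have pos: "?z < l \<and> l < ?j \<longleftrightarrow> x < ?e l \<and> ?e l < j" if "l \<in> {1..n}" for l
    using assms True that by (auto simp: exchange_def)
  have img: "?e ` {1..n} = {1..n}"
    using permutes_image[OF exchange_permutes[OF assms(1) xy assms(3)]] .
  have "(\<forall>l \<in> {1..n}. (\<sigma> \<circ> ?e) ?j < (\<sigma> \<circ> ?e) l \<longleftrightarrow> ?z < l \<and> l < ?j) \<longleftrightarrow>
      (\<forall>l \<in> {1..n}. \<sigma> j < \<sigma> (?e l) \<longleftrightarrow> x < ?e l \<and> ?e l < j)"
    using pos unfolding comp_apply ej by blast
  also have "\<dots> \<longleftrightarrow> (\<forall>m \<in> ?e ` {1..n}. \<sigma> j < \<sigma> m \<longleftrightarrow> x < m \<and> m < j)"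
    by blast
  finally have "(\<forall>l \<in> {1..n}. (\<sigma> \<circ> ?e) ?j < (\<sigma> \<circ> ?e) l \<longleftrightarrow> ?z < l \<and> l < ?j) \<longleftrightarrow>
      (\<forall>m \<in> {1..n}. \<sigma> j < \<sigma> m \<longleftrightarrow> x < m \<and> m < j)"
    unfolding img .
  moreover have "?z \<in> {1..n}" "?j \<in> {1..n}" "?z < ?j" "x \<in> {1..n}" "j \<in> {1..n}"
    using assms True by auto
  ultimately show ?thesis
    using True unfolding top_run_def by blast
qed

text \<open>
  The word \<open>L a K T\<close>: here \<open>a = \<sigma> x\<close>, the block \<open>a K\<close> occupies \<open>{x..<y}\<close>, and \<open>T\<close>, which is empty
  for \<open>y = n + 1\<close>, starts at \<open>y\<close> with a letter below \<open>a\<close>.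
\<close>

definition lr_split :: "nat \<Rightarrow> (nat \<Rightarrow> nat) \<Rightarrow> nat \<Rightarrow> nat \<Rightarrow> bool" where
  "lr_split n \<sigma> x y \<longleftrightarrow> 1 \<le> x \<and> x < y \<and> y \<le> n + 1 \<and>
     (\<forall>l \<in> {1..<x} \<union> {x<..<y}. \<sigma> x < \<sigma> l) \<and> (y \<le> n \<longrightarrow> \<sigma> y < \<sigma> x)"

text \<open>
  The word \<open>L T a K\<close>: here \<open>a = \<sigma> z\<close>, and \<open>T\<close>, which is empty for \<open>x = z\<close>, starts at \<open>x\<close> with the
  first letter below \<open>a\<close>.
\<close>

definition rl_split :: "nat \<Rightarrow> (nat \<Rightarrow> nat) \<Rightarrow> nat \<Rightarrow> nat \<Rightarrow> bool" where
  "rl_split n \<sigma> x z \<longleftrightarrow> 1 \<le> x \<and> x \<le> z \<and> z \<le> n \<and>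
     (\<forall>l \<in> {1..<x} \<union> {z<..n}. \<sigma> z < \<sigma> l) \<and> (x < z \<longrightarrow> \<sigma> x < \<sigma> z)"

lemma rl_split_exchange:
  assumes "1 \<le> x" "x < y" "y \<le> n + 1"
  shows "rl_split n (\<sigma> \<circ> exchange n x y) x (x + (n + 1 - y)) \<longleftrightarrow> lr_split n \<sigma> x y"
proof -
  let ?z = "x + (n + 1 - y)" and ?e = "exchange n x y"
  have ez: "?e ?z = x" using assms by (auto simp: exchange_def)
  have L: "?e ` {1..<x} = {1..<x}"
    using assms by (force simp: exchange_def)
  have K: "?e ` {?z<..n} = {x<..<y}"
  proof
    show "?e ` {?z<..n} \<subseteq> {x<..<y}"
      using assms by (auto simp: exchange_def)
    show "{x<..<y} \<subseteq> ?e ` {?z<..n}"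
    proof
      fix l assume "l \<in> {x<..<y}"
      then have "l = ?e (l + (n + 1 - y))" "l + (n + 1 - y) \<in> {?z<..n}"
        using assms by (auto simp: exchange_def)
      then show "l \<in> ?e ` {?z<..n}" by blast
    qed
  qed
  have T: "y \<le> n \<longleftrightarrow> x < ?z" "x < ?z \<Longrightarrow> ?e x = y"
    using assms by (auto simp: exchange_def)
  have "(\<forall>l \<in> {1..<x} \<union> {?z<..n}. \<sigma> x < \<sigma> (?e l)) \<longleftrightarrow>
      (\<forall>m \<in> ?e ` {1..<x} \<union> ?e ` {?z<..n}. \<sigma> x < \<sigma> m)"
    by blast
  moreover have "(x < ?z \<longrightarrow> \<sigma> (?e x) < \<sigma> x) \<longleftrightarrow> (y \<le> n \<longrightarrow> \<sigma> y < \<sigma> x)"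
    using T by metis
  moreover have "x \<le> ?z" "?z \<le> n"
    using assms by auto
  ultimately show ?thesis
    using assms unfolding rl_split_def lr_split_def comp_apply ez L K by blast
qed

lemma card_top_runs_exchange:
  assumes "lr_split n \<sigma> x y"
  shows "card {j. top_run n (\<sigma> \<circ> exchange n x y) (x + (n + 1 - y)) j} = card {j. top_run n \<sigma> x j}"
    (is "card ?S' = card ?S")
proof -
  from assms have xy: "1 \<le> x" "x < y" "y \<le> n + 1"
    and yx: "y \<le> n \<Longrightarrow> \<sigma> y < \<sigma> x"
    by (auto simp: lr_split_def)
  \<comment> \<open>A run to the right of \<open>x\<close> consists of values above \<open>\<sigma> x\<close>, so it stops before \<open>y\<close>.\<close>
  have before: "j < y" if "top_run n \<sigma> x j" for j
  proof (rule ccontr)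
    assume "\<not> j < y"
    with that have "y \<in> {1..n}" "x \<in> {1..n}" "y \<le> j" using xy by (auto simp: top_run_def)
    with that xy have "\<sigma> j \<le> \<sigma> y" "\<not> \<sigma> j < \<sigma> x"
      by (auto simp: top_run_def le_less)
    with yx \<open>y \<in> {1..n}\<close> show False by auto
  qed
  have "?S' = (\<lambda>j. j + (n + 1 - y)) ` ?S"
  proof
    show "(\<lambda>j. j + (n + 1 - y)) ` ?S \<subseteq> ?S'"
      using top_run_exchange[OF xy] before by auto
    show "?S' \<subseteq> (\<lambda>j. j + (n + 1 - y)) ` ?S"
    proof
      fix j' assume j': "j' \<in> ?S'"
      then have "x + (n + 1 - y) < j'" "j' \<le> n" by (auto simp: top_run_def)
      then have "j' = (j' - (n + 1 - y)) + (n + 1 - y)" "j' - (n + 1 - y) < y"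
        using xy by auto
      then obtain j where j: "j' = j + (n + 1 - y)" "j < y" by blast
      with j' top_run_exchange[OF xy j(2)] show "j' \<in> (\<lambda>j. j + (n + 1 - y)) ` ?S" by auto
    qed
  qed
  then show ?thesis by (simp add: card_image)
qed

text \<open>
  The bijection from \<open>L a K T\<close> to \<open>L T a K\<close>.  One formula serves for both directions, because
  a second exchange undoes the first.
\<close>

lemma card_lr_splits_eq_card_rl_splits:
  shows "card {(\<sigma>, x, y). \<sigma> permutes {1..n} \<and> lr_split n \<sigma> x y \<and> card {j. top_run n \<sigma> x j} \<in> C} =
    card {(\<sigma>, x, z). \<sigma> permutes {1..n} \<and> rl_split n \<sigma> x z \<and> card {j. top_run n \<sigma> z j} \<in> C}"
    (is "card ?A = card ?B")
proof -
  let ?f = "\<lambda>(\<sigma> :: nat \<Rightarrow> nat, x, y). (\<sigma> \<circ> exchange n x y, x, x + (n + 1 - y))"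
  have restore: "\<sigma> \<circ> exchange n x y \<circ> exchange n x (x + (n + 1 - y)) = \<sigma>"
      "x + (n + 1 - (x + (n + 1 - y))) = y"
    if "1 \<le> x" "x \<le> y" "y \<le> n + 1" for \<sigma> :: "nat \<Rightarrow> nat" and x y
    using exchange_exchange[OF that] that by (auto simp: fun_eq_iff)
  have "bij_betw ?f ?A ?B"
  proof (rule bij_betw_byWitness[where f' = ?f])
    show "\<forall>t \<in> ?A. ?f (?f t) = t"
      using restore by (auto simp: lr_split_def)
    show "\<forall>t \<in> ?B. ?f (?f t) = t"
      using restore by (auto simp: rl_split_def)
    show "?f ` ?A \<subseteq> ?B"
    proof (rule image_subsetI)
      fix t assume "t \<in> ?A"
      then obtain \<sigma> x y where t: "t = (\<sigma>, x, y)" and \<sigma>: "\<sigma> permutes {1..n}"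
        and s: "lr_split n \<sigma> x y" and K: "card {j. top_run n \<sigma> x j} \<in> C" by auto
      from s have xy: "1 \<le> x" "x < y" "y \<le> n + 1" "x \<le> y" by (auto simp: lr_split_def)
      have "\<sigma> \<circ> exchange n x y permutes {1..n}"
        using permutes_compose[OF exchange_permutes[OF xy(1,4,3)] \<sigma>] .
      moreover have "rl_split n (\<sigma> \<circ> exchange n x y) x (x + (n + 1 - y))"
        using rl_split_exchange[OF xy(1-3), of \<sigma>] s by blast
      moreover have "card {j. top_run n (\<sigma> \<circ> exchange n x y) (x + (n + 1 - y)) j} \<in> C"
        using card_top_runs_exchange[OF s] K by metis
      ultimately show "?f t \<in> ?B" unfolding t by simp
    qed
    show "?f ` ?B \<subseteq> ?A"
    proof (rule image_subsetI)
      fix t assume "t \<in> ?B"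
      then obtain \<sigma> x z where t: "t = (\<sigma>, x, z)" and \<sigma>: "\<sigma> permutes {1..n}"
        and s: "rl_split n \<sigma> x z" and K: "card {j. top_run n \<sigma> z j} \<in> C" by auto
      from s have xz: "1 \<le> x" "x \<le> z" "z \<le> n" "z \<le> n + 1" by (auto simp: rl_split_def)
      define y where "y = x + (n + 1 - z)"
      define \<tau> where "\<tau> = \<sigma> \<circ> exchange n x z"
      have y: "x < y" "y \<le> n + 1" using xz by (auto simp: y_def)
      have \<sigma>_eq: "\<tau> \<circ> exchange n x y = \<sigma>" and z_eq: "x + (n + 1 - y) = z"
        using restore[OF xz(1,2,4)] by (simp_all add: \<tau>_def y_def)
      have split: "lr_split n \<tau> x y"
        using rl_split_exchange[OF xz(1) y, of \<tau>] s unfolding \<sigma>_eq z_eq by simp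
      moreover have "card {j. top_run n \<tau> x j} \<in> C"
        using card_top_runs_exchange[OF split] K unfolding \<sigma>_eq z_eq by simp
      moreover have "\<tau> permutes {1..n}"
        using permutes_compose[OF exchange_permutes[OF xz(1,2,4)] \<sigma>] by (simp add: \<tau>_def)
      moreover have "?f t = (\<tau>, x, y)"
        by (simp add: t \<tau>_def y_def)
      ultimately show "?f t \<in> ?A" by simp
    qed
  qed
  then show ?thesis by (rule bij_betw_same_card)
qed

section \<open>From occurrences to splits\<close>

lemma card_occurrences_lr:
  assumes \<sigma>: "\<sigma> permutes {1..n}" and lr: "\<forall>l \<in> {1..<x}. \<sigma> x < \<sigma> l"
    and ne: "top_run n \<sigma> x j"
  shows "card (mesh12_occurrences n R_lr \<sigma>) = card {j. top_run n \<sigma> x j}"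
proof -
  have "mesh12_occurrences n R_lr \<sigma> = Pair x ` {j. top_run n \<sigma> x j}"
    using top_run_start_unique_lr[OF \<sigma> _ ne _ lr] lr
    unfolding mesh12_occurrences_def mesh12_occurrence_lr_iff[OF \<sigma>] by blast
  then show ?thesis by (simp add: card_image inj_on_def)
qed

lemma card_occurrences_rl:
  assumes \<sigma>: "\<sigma> permutes {1..n}" and rl: "\<forall>l \<in> {z<..n}. \<sigma> z < \<sigma> l"
    and ne: "top_run n \<sigma> z j"
  shows "card (mesh12_occurrences n R_rl \<sigma>) = card {j. top_run n \<sigma> z j}"
proof -
  have "mesh12_occurrences n R_rl \<sigma> = Pair z ` {j. top_run n \<sigma> z j}"
    using top_run_start_unique_rl[OF \<sigma> _ ne _ rl] rl
    unfolding mesh12_occurrences_def mesh12_occurrence_rl_iff[OF \<sigma>] by blast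
  then show ?thesis by (simp add: card_image inj_on_def)
qed

text \<open>
  A marked left-to-right minimum determines \<open>K\<close> and \<open>T\<close>, a marked right-to-left minimum determines
  \<open>L\<close> and \<open>T\<close>; so counting splits is counting marked permutations.
\<close>

lemma lr_split_exists:
  assumes \<sigma>: "\<sigma> permutes {1..n}" and x: "x \<in> {1..n}" and lr: "\<forall>l \<in> {1..<x}. \<sigma> x < \<sigma> l"
  shows "\<exists>y. lr_split n \<sigma> x y"
proof -
  define P where "P y \<longleftrightarrow> x < y \<and> (y \<le> n \<longrightarrow> \<sigma> y < \<sigma> x)" for y
  define y where "y = (LEAST y. P y)"
  have "P (n + 1)" using x by (simp add: P_def)
  then have y: "P y" "y \<le> n + 1"
    unfolding y_def using LeastI[of P "n + 1"] Least_le[of P "n + 1"] by blast+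
  have "\<sigma> x < \<sigma> l" if "l \<in> {x<..<y}" for l
  proof -
    have "\<not> P l" using that not_less_Least[of l P] by (simp add: y_def)
    then have "\<not> \<sigma> l < \<sigma> x" using that by (simp add: P_def)
    moreover have "\<sigma> l \<noteq> \<sigma> x" using that inj_eq[OF permutes_inj[OF \<sigma>]] by simp
    ultimately show ?thesis by simp
  qed
  with y x lr have "lr_split n \<sigma> x y" by (auto simp: lr_split_def P_def)
  then show ?thesis ..
qed

lemma rl_split_exists:
  assumes \<sigma>: "\<sigma> permutes {1..n}" and z: "z \<in> {1..n}" and rl: "\<forall>l \<in> {z<..n}. \<sigma> z < \<sigma> l"
  shows "\<exists>x. rl_split n \<sigma> x z"
proof -
  define P where "P x \<longleftrightarrow> 1 \<le> x \<and> (x < z \<longrightarrow> \<sigma> x < \<sigma> z)" for x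
  define x where "x = (LEAST x. P x)"
  have "P z" using z by (simp add: P_def)
  then have x: "P x" "x \<le> z"
    unfolding x_def using LeastI[of P z] Least_le[of P z] by blast+
  have "\<sigma> z < \<sigma> l" if "l \<in> {1..<x}" for l
  proof -
    have "\<not> P l" using that not_less_Least[of l P] by (simp add: x_def)
    then have "\<not> \<sigma> l < \<sigma> z" using that by (simp add: P_def)
    moreover have "\<sigma> l \<noteq> \<sigma> z" using that x inj_eq[OF permutes_inj[OF \<sigma>]] by simp
    ultimately show ?thesis by simp
  qed
  with x z rl have "rl_split n \<sigma> x z" by (auto simp: rl_split_def P_def)
  then show ?thesis ..
qed

lemma lr_split_unique:
  assumes "lr_split n \<sigma> x y" "lr_split n \<sigma> x y'"
  shows "y = y'"
proof -
  have "\<not> a < b" if "lr_split n \<sigma> x a" "lr_split n \<sigma> x b" for a b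
  proof
    assume "a < b"
    with that have "a \<le> n" "a \<in> {x<..<b}" by (auto simp: lr_split_def)
    with that have "\<sigma> a < \<sigma> x" "\<sigma> x < \<sigma> a" unfolding lr_split_def by blast+
    then show False by simp
  qed
  with assms show ?thesis by (meson linorder_neqE_nat)
qed

lemma rl_split_unique:
  assumes "rl_split n \<sigma> x z" "rl_split n \<sigma> x' z"
  shows "x = x'"
proof -
  have "\<not> a < b" if "rl_split n \<sigma> a z" "rl_split n \<sigma> b z" for a b
  proof
    assume "a < b"
    with that have "a < z" "a \<in> {1..<b}" by (auto simp: rl_split_def)
    with that have "\<sigma> a < \<sigma> z" "\<sigma> z < \<sigma> a" unfolding rl_split_def by blast+
    then show False by simp
  qed
  with assms show ?thesis by (meson linorder_neqE_nat)
qed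

text \<open>
  The assumption on \<open>C\<close> provides an occurrence, and the start of an occurrence is unique; this
  makes forgetting the marked letter injective.
\<close>

lemma card_lr_eq_card_splits:
  assumes "0 \<notin> C"
  shows "card {\<sigma>. \<sigma> permutes {1..n} \<and> card (mesh12_occurrences n R_lr \<sigma>) \<in> C} =
    card {(\<sigma>, x, y). \<sigma> permutes {1..n} \<and> lr_split n \<sigma> x y \<and> card {j. top_run n \<sigma> x j} \<in> C}"
    (is "card ?P = card ?T")
proof -
  have run: "\<exists>j. top_run n \<sigma> x j" if "card {j. top_run n \<sigma> x j} \<in> C" for \<sigma> x
    using that assms by (metis Collect_empty_eq card.empty)
  have lr: "\<forall>l \<in> {1..<x}. \<sigma> x < \<sigma> l" if "lr_split n \<sigma> x y" for \<sigma> x y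
    using that by (simp add: lr_split_def)
  have "bij_betw fst ?T ?P"
  proof (rule bij_betwI')
    fix t t' assume t: "t \<in> ?T" "t' \<in> ?T"
    show "fst t = fst t' \<longleftrightarrow> t = t'"
    proof
      assume "fst t = fst t'"
      with t obtain \<sigma> x y x' y' where eq: "t = (\<sigma>, x, y)" "t' = (\<sigma>, x', y')" by (cases t, cases t') auto
      with t have *: "\<sigma> permutes {1..n}" "lr_split n \<sigma> x y" "lr_split n \<sigma> x' y'"
        "card {j. top_run n \<sigma> x j} \<in> C" "card {j. top_run n \<sigma> x' j} \<in> C" by auto
      then have "x = x'"
        using run top_run_start_unique_lr[OF *(1) _ _ lr lr] by metis
      with * eq show "t = t'" using lr_split_unique by simp
    qed simp
  next
    fix t assume "t \<in> ?T"
    then obtain \<sigma> x y where eq: "t = (\<sigma>, x, y)" and *: "\<sigma> permutes {1..n}" "lr_split n \<sigma> x y"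
      "card {j. top_run n \<sigma> x j} \<in> C" by auto
    from run[OF *(3)] obtain j where "top_run n \<sigma> x j" ..
    with * eq card_occurrences_lr[OF *(1) lr[OF *(2)]] show "fst t \<in> ?P" by simp
  next
    fix \<sigma> assume "\<sigma> \<in> ?P"
    then have \<sigma>: "\<sigma> permutes {1..n}" and K: "card (mesh12_occurrences n R_lr \<sigma>) \<in> C" by auto
    then have "mesh12_occurrences n R_lr \<sigma> \<noteq> {}" using assms by force
    then obtain x j where *: "top_run n \<sigma> x j" "\<forall>l \<in> {1..<x}. \<sigma> x < \<sigma> l"
      unfolding mesh12_occurrences_def mesh12_occurrence_lr_iff[OF \<sigma>] by blast
    then have "x \<in> {1..n}" by (simp add: top_run_def)
    with lr_split_exists[OF \<sigma> _ *(2)] obtain y where "lr_split n \<sigma> x y" by blast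
    with \<sigma> K card_occurrences_lr[OF \<sigma> *(2,1)] have "(\<sigma>, x, y) \<in> ?T" by simp
    then show "\<exists>t \<in> ?T. \<sigma> = fst t" by force
  qed
  then show ?thesis by (simp add: bij_betw_same_card)
qed

lemma card_rl_eq_card_splits:
  assumes "0 \<notin> C"
  shows "card {\<sigma>. \<sigma> permutes {1..n} \<and> card (mesh12_occurrences n R_rl \<sigma>) \<in> C} =
    card {(\<sigma>, x, z). \<sigma> permutes {1..n} \<and> rl_split n \<sigma> x z \<and> card {j. top_run n \<sigma> z j} \<in> C}"
    (is "card ?P = card ?T")
proof -
  have run: "\<exists>j. top_run n \<sigma> z j" if "card {j. top_run n \<sigma> z j} \<in> C" for \<sigma> z
    using that assms by (metis Collect_empty_eq card.empty)
  have rl: "\<forall>l \<in> {z<..n}. \<sigma> z < \<sigma> l" if "rl_split n \<sigma> x z" for \<sigma> x z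
    using that by (simp add: rl_split_def)
  have "bij_betw fst ?T ?P"
  proof (rule bij_betwI')
    fix t t' assume t: "t \<in> ?T" "t' \<in> ?T"
    show "fst t = fst t' \<longleftrightarrow> t = t'"
    proof
      assume "fst t = fst t'"
      with t obtain \<sigma> x z x' z' where eq: "t = (\<sigma>, x, z)" "t' = (\<sigma>, x', z')" by (cases t, cases t') auto
      with t have *: "\<sigma> permutes {1..n}" "rl_split n \<sigma> x z" "rl_split n \<sigma> x' z'"
        "card {j. top_run n \<sigma> z j} \<in> C" "card {j. top_run n \<sigma> z' j} \<in> C" by auto
      then have "z = z'"
        using run top_run_start_unique_rl[OF *(1) _ _ rl rl] by metis
      with * eq show "t = t'" using rl_split_unique by simp
    qed simp
  next
    fix t assume "t \<in> ?T"
    then obtain \<sigma> x z where eq: "t = (\<sigma>, x, z)" and *: "\<sigma> permutes {1..n}" "rl_split n \<sigma> x z"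
      "card {j. top_run n \<sigma> z j} \<in> C" by auto
    from run[OF *(3)] obtain j where "top_run n \<sigma> z j" ..
    with * eq card_occurrences_rl[OF *(1) rl[OF *(2)]] show "fst t \<in> ?P" by simp
  next
    fix \<sigma> assume "\<sigma> \<in> ?P"
    then have \<sigma>: "\<sigma> permutes {1..n}" and K: "card (mesh12_occurrences n R_rl \<sigma>) \<in> C" by auto
    then have "mesh12_occurrences n R_rl \<sigma> \<noteq> {}" using assms by force
    then obtain z j where *: "top_run n \<sigma> z j" "\<forall>l \<in> {z<..n}. \<sigma> z < \<sigma> l"
      unfolding mesh12_occurrences_def mesh12_occurrence_rl_iff[OF \<sigma>] by blast
    then have "z \<in> {1..n}" by (simp add: top_run_def)
    with rl_split_exists[OF \<sigma> _ *(2)] obtain x where "rl_split n \<sigma> x z" by blast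
    with \<sigma> K card_occurrences_rl[OF \<sigma> *(2,1)] have "(\<sigma>, x, z) \<in> ?T" by simp
    then show "\<exists>t \<in> ?T. \<sigma> = fst t" by force
  qed
  then show ?thesis by (simp add: bij_betw_same_card)
qed

lemma equidistributed_lr_rl: "equidistributed_mesh12 R_lr R_rl"
  unfolding equidistributed_mesh12_def
proof (intro allI)
  fix n k
  let ?N = "\<lambda>R C. {\<sigma>. \<sigma> permutes {1..n} \<and> card (mesh12_occurrences n R \<sigma>) \<in> C}"
  have pos: "card (?N R_lr C) = card (?N R_rl C)" if "0 \<notin> C" for C
    unfolding card_lr_eq_card_splits[OF that] card_rl_eq_card_splits[OF that]
    by (rule card_lr_splits_eq_card_rl_splits)
  have s: "s_mesh12 n k R = card (?N R {k})" for R
    by (simp add: s_mesh12_def)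
  show "s_mesh12 n k R_lr = s_mesh12 n k R_rl"
  proof (cases "k = 0")
    case False
    then show ?thesis unfolding s using pos[of "{k}"] by simp
  next
    case True
    \<comment> \<open>Without occurrences no letter is distinguished, so the complement is counted.\<close>
    have fin: "finite {\<sigma>. \<sigma> permutes {1..n}}"
      by (simp add: finite_permutations)
    have compl: "card (?N R {0}) = card {\<sigma>. \<sigma> permutes {1..n}} - card (?N R (- {0}))" for R
    proof -
      have "?N R {0} = {\<sigma>. \<sigma> permutes {1..n}} - ?N R (- {0})" by auto
      moreover have sub: "?N R (- {0}) \<subseteq> {\<sigma>. \<sigma> permutes {1..n}}" by auto
      ultimately show ?thesis
        using card_Diff_subset[OF finite_subset[OF sub fin] sub] by argo
    qed
    have "card (?N R_lr (- {0})) = card (?N R_rl (- {0}))"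
      by (rule pos) simp
    then show ?thesis unfolding s unfolding True compl by (rule arg_cong)
  qed
qed

section \<open>The eight patterns\<close>

lemma equidistributed_mesh12_converse: "equidistributed_mesh12 R (R\<inverse>)"
  by (simp add: equidistributed_mesh12_def s_mesh12_converse)

lemma equidistributed_mesh12_half_turn:
  "R \<subseteq> {..2} \<times> {..2} \<Longrightarrow> equidistributed_mesh12 R (map_prod ((-) 2) ((-) 2) ` R)"
  by (simp add: equidistributed_mesh12_def s_mesh12_half_turn)

theorem theorem2p3:
  fixes \<R> :: "(nat \<times> nat) set set"
  defines "\<R> \<equiv>
    {{(0,2), (2,2), (1,1), (2,1), (0,0)},
     {(0,2), (2,2), (1,1), (0,0), (1,0)},
     {(1,2), (2,2), (1,1), (0,0), (2,0)},
     {(2,2), (0,1), (1,1), (0,0), (2,0)},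
     {(0,2), (2,2), (0,1), (1,1), (2,0)},
     {(0,2), (1,2), (1,1), (0,0), (2,0)},
     {(0,2), (1,1), (2,1), (0,0), (2,0)},
     {(0,2), (2,2), (1,1), (1,0), (2,0)}}"
  shows "\<forall>R \<in> \<R>. \<forall>R' \<in> \<R>. equidistributed_mesh12 R R'"
proof -
  have trans: "equidistributed_mesh12 R R''"
    if "equidistributed_mesh12 R R'" "equidistributed_mesh12 R' R''" for R R' R''
    using that by (simp add: equidistributed_mesh12_def)
  have orbit: "equidistributed_mesh12 R (R\<inverse>)"
      "equidistributed_mesh12 R (map_prod ((-) 2) ((-) 2) ` R)"
      "equidistributed_mesh12 R (map_prod ((-) 2) ((-) 2) ` (R\<inverse>))"
    if "R \<subseteq> {..2} \<times> {..2}" for R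
  proof -
    have "R\<inverse> \<subseteq> {..2} \<times> {..2}" using that by auto
    then show "equidistributed_mesh12 R (map_prod ((-) 2) ((-) 2) ` (R\<inverse>))"
      using trans equidistributed_mesh12_converse equidistributed_mesh12_half_turn by blast
  qed (use that equidistributed_mesh12_converse equidistributed_mesh12_half_turn in auto)
  have conv: "(insert (a, b) S)\<inverse> = insert (b, a) (S\<inverse>)" for a b :: nat and S
    by auto
  have lr: "equidistributed_mesh12 R_lr {(2,2), (0,1), (1,1), (0,0), (2,0)}"
    "equidistributed_mesh12 R_lr {(1,2), (2,2), (1,1), (0,0), (2,0)}"
    "equidistributed_mesh12 R_lr {(0,2), (2,2), (1,1), (2,1), (0,0)}"
    using orbit[of R_lr] by (simp_all add: insert_commute conv)
  have rl: "equidistributed_mesh12 R_rl {(0,2), (2,2), (0,1), (1,1), (2,0)}"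
    "equidistributed_mesh12 R_rl {(0,2), (1,2), (1,1), (0,0), (2,0)}"
    "equidistributed_mesh12 R_rl {(0,2), (1,1), (2,1), (0,0), (2,0)}"
    using orbit[of R_rl] by (simp_all add: insert_commute conv)
  have listed: "equidistributed_mesh12 R_lr {(0,2), (2,2), (1,1), (0,0), (1,0)}"
    "equidistributed_mesh12 R_rl {(0,2), (2,2), (1,1), (1,0), (2,0)}"
    by (simp_all add: equidistributed_mesh12_def insert_commute)
  have "equidistributed_mesh12 R_lr R" if "R \<in> \<R>" for R
    using that[unfolded \<R>_def] listed(1) lr
      listed(2)[THEN trans[OF equidistributed_lr_rl]] rl[THEN trans[OF equidistributed_lr_rl]]
    by (elim insertE emptyE) (simp_all only:)
  then show ?thesis
    unfolding equidistributed_mesh12_def by metis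
qed

end
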